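(* Let $m\ge0$, let $\mathbf{w}(t)=\sum_{k=0}^m\mathbf{c}_kL_k(t)$ be a complex pre-image polynomial with $\int_0^1\mathbf{w}^2(t)\,dt=1$, let $d>0$, and let $\delta\mathbf{w}(t)=\sum_{k=0}^m\delta\mathbf{c}_kL_k(t)$ with $\delta\mathbf{c}_k=\rho_k\,e^{\mathrm{i}\varphi}$ for $k=0,\dots,m$, where $\rho_0,\dots,\rho_m\in\mathbb{R}$ and $\varphi\in(-\pi,\pi]$ is common to all coefficients. Then $\delta\mathbf{w}$ satisfies both $$\|\delta\mathbf{w}\|=d\quad\text{and}\quad\int_0^1(\mathbf{w}(t)+\delta\mathbf{w}(t))^2\,dt=1$$ if and only if $\sum_{k=0}^m\rho_k^2=d^2$ and $$d^2\cos(2\varphi)+2\sum_{k=0}^m\rho_k\bigl(\cos\varphi\,\mathrm{Re}(\mathbf{c}_k)-\sin\varphi\,\mathrm{Im}(\mathbf{c}_k)\bigr)=0,$$ $$d^2\sin(2\varphi)+2\sum_{k=0}^m\rho_k\bigl(\cos\varphi\,\mathrm{Im}(\mathbf{c}_k)+\sin\varphi\,\mathrm{Re}(\mathbf{c}_k)\bigr)=0.$$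
   Context: For a complex polynomial $\mathbf{u}$ in the real variable $t\in[0,1]$, $\|\mathbf{u}\|=\left(\int_0^1|\mathbf{u}(t)|^2\,dt\right)^{1/2}$. $L_k$ are the real orthonormal Legendre polynomials on $[0,1]$: $L_k(t)=\sqrt{2k+1}\sum_{i=0}^k(-1)^{k+i}\binom{k}{i}\binom{k}{i}(1-t)^{k-i}t^i$, satisfying $\int_0^1L_jL_k\,dt=\delta_{jk}$. A pre-image polynomial $\mathbf{w}$ generates the planar Pythagorean-hodograph curve $\mathbf{r}(t)=\int_0^t\mathbf{w}^2(\tau)\,d\tau$; the condition $\int_0^1\mathbf{w}^2\,dt=1$ means that $\mathbf{r}(0)=0$ and $\mathbf{r}(1)=1$ (canonical form), so the second displayed requirement says that the perturbed curve keeps these end points. *)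

theory Defs
  imports "HOL-Analysis.Analysis"
begin

definition legendre01 :: "nat \<Rightarrow> real \<Rightarrow> real" where
  "legendre01 k t = sqrt (2 * real k + 1) *
     (\<Sum>i=0..k. (-1) ^ (k + i) * real (k choose i) * real (k choose i) * (1 - t) ^ (k - i) * t ^ i)"

definition norm01 :: "(real \<Rightarrow> complex) \<Rightarrow> real" where
  "norm01 u = sqrt (integral {0..1} (\<lambda>t. (cmod (u t))\<^sup>2))"

end

theory Submission
  imports Defs "HOL-Computational_Algebra.Polynomial"
begin

text \<open>
  Everything rests on the orthonormality of the functions \<open>legendre01 k\<close>
  (\<open>legendre01_orthonormal\<close>), which turns integrals of products into sums over coefficients
  (\<open>has_integral_legendre01_expansions\<close>). In particular \<open>canonical\<close> becomes
  \<open>\<Sum> c\<^sub>k\<^sup>2 = 1\<close>, and the perturbed integral is \<open>\<Sum> (c\<^sub>k + \<delta>c\<^sub>k)\<^sup>2\<close>. With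
  \<open>\<delta>c\<^sub>k = \<rho>\<^sub>k cis \<phi>\<close> the end point condition reduces to the single complex equation
  \<open>(\<Sum> \<rho>\<^sub>k\<^sup>2) cis (2\<phi>) + 2 cis \<phi> (\<Sum> \<rho>\<^sub>k c\<^sub>k) = 0\<close>, whose real and imaginary parts are
  the two real equations once \<open>\<Sum> \<rho>\<^sub>k\<^sup>2 = d\<^sup>2\<close>. Because the phase is common,
  \<open>\<delta>w\<close> is a unit complex number times a real polynomial with coefficients \<open>\<rho>\<^sub>k\<close>, so its
  squared norm is \<open>\<Sum> \<rho>\<^sub>k\<^sup>2\<close>.

  Orthonormality is proved from the explicit Bernstein form, without Rodrigues' formula. The Beta
  integral turns the moment \<open>\<integral> P\<^sub>k t\<^sup>j\<close> of the unnormalised polynomial into a \<open>k\<close>-th finite difference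
  of the binomial coefficient \<open>(i + j) choose j\<close>, a polynomial of degree \<open>j\<close> in \<open>i\<close>. It therefore
  vanishes for \<open>j < k\<close>, so \<open>P\<^sub>k\<close> is orthogonal to all polynomials of smaller degree, and the
  squared norm of \<open>P\<^sub>k\<close> is the \<open>k\<close>-th moment times the leading coefficient of \<open>P\<^sub>k\<close>.
\<close>

section \<open>A Beta integral and a finite difference\<close>

text \<open>
  Integration by parts lowers the exponent of \<open>1 - t\<close>: the antiderivative
  \<open>(1 - t)\<^sup>b\<^sup>+\<^sup>1 t\<^sup>a\<^sup>+\<^sup>1\<close> vanishes at both end points.
\<close>
lemma has_integral_power_mult_power_compl:
  "((\<lambda>t::real. (1 - t) ^ b * t ^ a) has_integral (fact a * fact b / fact (a + b + 1))) {0..1}"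
proof (induction b arbitrary: a)
  case 0
  have "((\<lambda>t::real. t ^ a) has_integral (1 ^ Suc a / real (Suc a) - 0 ^ Suc a / real (Suc a))) {0..1}"
    by (rule fundamental_theorem_of_calculus)
       (auto simp flip: has_real_derivative_iff_has_vector_derivative
          intro!: derivative_eq_intros simp del: of_nat_Suc power_Suc)
  moreover have "fact a / fact (a + 1) = (1 / real (Suc a))"
    by (simp add: divide_simps)
  ultimately show ?case
    by simp
next
  case (Suc b)
  let ?J = "fact (Suc a) * fact b / fact (Suc a + b + 1) :: real"
  have IH: "((\<lambda>t::real. (1 - t) ^ b * t ^ Suc a) has_integral ?J) {0..1}"
    by (rule Suc)
  have "((\<lambda>t::real. real (Suc a) * ((1 - t) ^ Suc b * t ^ a) - real (Suc b) * ((1 - t) ^ b * t ^ Suc a))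
      has_integral ((1 - 1) ^ Suc b * 1 ^ Suc a - (1 - 0) ^ Suc b * 0 ^ Suc a)) {0..1}"
    by (rule fundamental_theorem_of_calculus)
       (auto simp flip: has_real_derivative_iff_has_vector_derivative
          intro!: derivative_eq_intros simp del: of_nat_Suc power_Suc)
  from has_integral_add[OF this has_integral_mult_right[OF IH, of "real (Suc b)"]]
  have "((\<lambda>t::real. real (Suc a) * ((1 - t) ^ Suc b * t ^ a)) has_integral (real (Suc b) * ?J)) {0..1}"
    by simp
  from has_integral_mult_right[OF this, of "1 / real (Suc a)"]
  have "((\<lambda>t::real. (1 - t) ^ Suc b * t ^ a) has_integral (real (Suc b) * ?J / real (Suc a))) {0..1}"
    by (simp del: of_nat_Suc power_Suc)
  moreover have "real (Suc b) * ?J / real (Suc a) = fact a * fact (Suc b) / fact (a + Suc b + 1)"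
    by (simp add: fact_Suc[of a] fact_Suc[of b] del: of_nat_Suc fact_Suc)
  ultimately show ?case
    by (simp only:)
qed

text \<open>
  The sum is the \<open>k\<close>-th forward difference at \<open>n\<close> of \<open>x \<mapsto> x choose j\<close>, and by Pascal's rule each
  difference lowers \<open>j\<close> by one. The base point \<open>n\<close> is kept general because the induction step
  compares the differences at \<open>n + 1\<close> and at \<open>n\<close>.
\<close>
lemma alternating_sum_choose_shifted:
  "(\<Sum>i\<le>k. (-1) ^ (k + i) * real (k choose i) * real ((i + n) choose j)) =
     (if k \<le> j then real (n choose (j - k)) else 0)"
proof (induction k arbitrary: n)
  case 0
  show ?case by simp
next
  case (Suc k)
  \<comment> \<open>Pascal's rule splits \<open>Suc k choose i\<close>; the case distinction stands for \<open>k choose (i - 1)\<close>,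
      which must be 0 at \<open>i = 0\<close> although natural subtraction truncates.\<close>
  let ?D = "\<lambda>k n. \<Sum>i\<le>k. (-1) ^ (k + i) * real (k choose i) * real ((i + n) choose j)"
  have shift: "(\<Sum>i\<le>Suc k. (-1) ^ (Suc k + i) * real (case i of 0 \<Rightarrow> 0 | Suc i' \<Rightarrow> k choose i')
                 * real ((i + n) choose j)) = ?D k (Suc n)"
    by (simp add: sum.atMost_Suc_shift del: sum.atMost_Suc)
  have keep: "(\<Sum>i\<le>Suc k. (-1) ^ (Suc k + i) * real (k choose i) * real ((i + n) choose j)) = - ?D k n"
    by (simp add: sum_negf)
  have "?D (Suc k) n = (\<Sum>i\<le>Suc k. (-1) ^ (Suc k + i) * real (k choose i) * real ((i + n) choose j)
      + (-1) ^ (Suc k + i) * real (case i of 0 \<Rightarrow> 0 | Suc i' \<Rightarrow> k choose i') * real ((i + n) choose j))"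
    by (intro sum.cong refl) (auto split: nat.splits simp: algebra_simps)
  also have "\<dots> = ?D k (Suc n) - ?D k n"
    unfolding sum.distrib keep shift by simp
  also have "\<dots> = (if Suc k \<le> j then real (n choose (j - Suc k)) else 0)"
    unfolding Suc.IH by (cases "j - k") (auto simp: le_Suc_eq Suc_le_eq Suc_diff_Suc[symmetric])
  finally show ?case .
qed

section \<open>Orthonormality of the Legendre polynomials\<close>

text \<open>
  The polynomial without the normalising factor, as a formal object, so that degree and leading
  coefficient can be spoken of.
\<close>
definition legendre_poly :: "nat \<Rightarrow> real poly" where
  "legendre_poly k = (\<Sum>i\<le>k. smult ((-1) ^ (k + i) * (real (k choose i))\<^sup>2) ([:1, -1:] ^ (k - i) * [:0, 1:] ^ i))"

lemma poly_legendre_poly: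
  "poly (legendre_poly k) t = (\<Sum>i\<le>k. (-1) ^ (k + i) * (real (k choose i))\<^sup>2 * ((1 - t) ^ (k - i) * t ^ i))"
  by (simp add: legendre_poly_def poly_sum)

lemma legendre01_eq_poly: "legendre01 k t = sqrt (2 * real k + 1) * poly (legendre_poly k) t"
  by (simp add: legendre01_def poly_legendre_poly atLeast0AtMost power2_eq_square mult.assoc)

text \<open>
  After the Beta integral, the factorials cancel one of the two factors \<open>k choose i\<close> and combine to
  \<open>(i + j) choose j\<close>; what is left is a finite difference at base point \<open>j\<close>. For
  \<open>j < k\<close> the value is 0 through \<open>j choose k = 0\<close>.
\<close>
lemma has_integral_legendre_poly_power:
  "((\<lambda>t. poly (legendre_poly k) t * t ^ j) has_integral
      (fact k * fact j / fact (k + j + 1) * real (j choose k))) {0..1}"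
proof -
  have "((\<lambda>t. \<Sum>i\<le>k. (-1) ^ (k + i) * (real (k choose i))\<^sup>2 * ((1 - t) ^ (k - i) * t ^ (i + j))) has_integral
      (\<Sum>i\<le>k. (-1) ^ (k + i) * (real (k choose i))\<^sup>2 * (fact (i + j) * fact (k - i) / fact (i + j + (k - i) + 1)))) {0..1}"
    by (intro has_integral_sum has_integral_mult_right has_integral_power_mult_power_compl) auto
  moreover have "(\<Sum>i\<le>k. (-1) ^ (k + i) * (real (k choose i))\<^sup>2 * (fact (i + j) * fact (k - i) / fact (i + j + (k - i) + 1)))
      = (\<Sum>i\<le>k. fact k * fact j / fact (k + j + 1) * ((-1) ^ (k + i) * real (k choose i) * real ((i + j) choose j)))"
    (is "?l = _")
  proof (intro sum.cong refl)
    fix i assume "i \<in> {..k}"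
    then have "i \<le> k" by simp
    then have "i + j + (k - i) + 1 = k + j + 1"
      and "real (k choose i) = fact k / (fact i * fact (k - i))"
      and "real ((i + j) choose j) = fact (i + j) / (fact j * fact i)"
      by (simp_all add: binomial_fact)
    then show "(-1) ^ (k + i) * (real (k choose i))\<^sup>2 * (fact (i + j) * fact (k - i) / fact (i + j + (k - i) + 1))
      = fact k * fact j / fact (k + j + 1) * ((-1) ^ (k + i) * real (k choose i) * real ((i + j) choose j))"
      by (simp add: power2_eq_square ac_simps del: fact_Suc)
  qed
  moreover have "\<dots> = fact k * fact j / fact (k + j + 1) * real (j choose k)"
    unfolding sum_distrib_left[symmetric] alternating_sum_choose_shifted
    by (auto simp: binomial_symmetric[of k j])
  ultimately show ?thesis
    by (simp add: poly_legendre_poly sum_distrib_right power_add mult.assoc)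
qed

lemma degree_legendre_poly: "degree (legendre_poly k) \<le> k"
  unfolding legendre_poly_def
proof (intro degree_sum_le)
  fix i assume "i \<in> {..k}"
  then show "degree (smult ((-1) ^ (k + i) * (real (k choose i))\<^sup>2) ([:1, -1:] ^ (k - i) * [:0, 1:] ^ i)) \<le> k"
    by (simp add: degree_mult_eq degree_power_eq)
qed simp

text \<open>
  The sign of each Bernstein term cancels against the leading sign of \<open>(1 - t)\<^sup>k\<^sup>-\<^sup>i\<close>, which leaves
  the sum of the squares of a row of Pascal's triangle.
\<close>
lemma coeff_legendre_poly: "coeff (legendre_poly k) k = real ((2 * k) choose k)"
proof -
  have "coeff (legendre_poly k) k = (\<Sum>i\<le>k. (real (k choose i))\<^sup>2)"
    unfolding legendre_poly_def coeff_sum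
  proof (intro sum.cong refl)
    fix i assume "i \<in> {..k}"
    then have i: "i \<le> k" by simp
    have deg: "degree ([:1, -1:] ^ (k - i) * [:0, 1:] ^ i :: real poly) = k"
      using i by (simp add: degree_mult_eq degree_power_eq)
    have "lead_coeff ([:1, -1:] ^ (k - i) * [:0, 1:] ^ i :: real poly) = (-1) ^ (k - i)"
      by (simp add: lead_coeff_mult lead_coeff_power)
    then have "coeff ([:1, -1:] ^ (k - i) * [:0, 1:] ^ i :: real poly) k = (-1) ^ (k - i)"
      by (simp only: deg)
    moreover have "(-1) ^ (k + i) * (-1) ^ (k - i) = (1::real)"
      using i by (simp flip: power_add)
    ultimately show "coeff (smult ((-1) ^ (k + i) * (real (k choose i))\<^sup>2) ([:1, -1:] ^ (k - i) * [:0, 1:] ^ i)) k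
        = (real (k choose i))\<^sup>2"
      by (simp add: mult.commute mult.left_commute)
  qed
  also have "\<dots> = real (\<Sum>i\<le>k. (k choose i)\<^sup>2)"
    by simp
  also have "\<dots> = real ((2 * k) choose k)"
    by (simp only: choose_square_sum)
  finally show ?thesis .
qed

text \<open>
  Only the top moment survives. Taking \<open>q\<close> of smaller degree gives orthogonality, and \<open>q = P\<^sub>k\<close>
  gives the squared norm, from one formula.
\<close>
lemma has_integral_legendre_poly_mult_poly:
  assumes "degree q \<le> k"
  shows "((\<lambda>t. poly (legendre_poly k) t * poly q t) has_integral
      (coeff q k * ((fact k)\<^sup>2 / fact (2 * k + 1)))) {0..1}"
proof -
  have "((\<lambda>t. \<Sum>j\<le>k. coeff q j * (poly (legendre_poly k) t * t ^ j)) has_integral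
      (\<Sum>j\<le>k. coeff q j * (fact k * fact j / fact (k + j + 1) * real (j choose k)))) {0..1}"
    by (intro has_integral_sum has_integral_mult_right has_integral_legendre_poly_power) auto
  moreover have "(\<Sum>j\<le>k. coeff q j * (fact k * fact j / fact (k + j + 1) * real (j choose k)))
      = (\<Sum>j\<le>k. if j = k then coeff q k * ((fact k)\<^sup>2 / fact (2 * k + 1)) else 0)"
    by (intro sum.cong refl) (auto simp: power2_eq_square binomial_eq_0 simp flip: mult_2)
  moreover have "poly (legendre_poly k) t * poly q t = (\<Sum>j\<le>k. coeff q j * (poly (legendre_poly k) t * t ^ j))" for t
  proof -
    have "poly q t = (\<Sum>j\<le>k. coeff q j * t ^ j)"
      unfolding poly_altdef using assms
      by (intro sum.mono_neutral_left) (auto simp: coeff_eq_0 not_le)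
    then show ?thesis
      by (simp add: sum_distrib_left mult.left_commute)
  qed
  ultimately show ?thesis
    by simp
qed

lemma legendre01_orthonormal:
  "((\<lambda>t. legendre01 j t * legendre01 k t) has_integral (if j = k then 1 else 0)) {0..1}"
proof (induction j k rule: linorder_wlog)
  case (sym j k)
  then show ?case by (simp add: mult.commute eq_commute)
next
  case (le j k)
  have "coeff (legendre_poly j) k * ((fact k)\<^sup>2 / fact (2 * k + 1)) = (if j = k then 1 / (2 * real k + 1) else 0)"
  proof (cases "j = k")
    case True
    have "real ((2 * k) choose k) = fact (2 * k) / (fact k * fact k)"
      by (simp add: binomial_fact mult_2)
    then show ?thesis
      using True by (simp add: coeff_legendre_poly power2_eq_square)
  next
    case False
    with le degree_legendre_poly[of j] show ?thesis
      by (simp add: coeff_eq_0)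
  qed
  moreover have "degree (legendre_poly j) \<le> k"
    using degree_legendre_poly[of j] le by simp
  ultimately have "((\<lambda>t. poly (legendre_poly k) t * poly (legendre_poly j) t) has_integral
      (if j = k then 1 / (2 * real k + 1) else 0)) {0..1}"
    using has_integral_legendre_poly_mult_poly[of "legendre_poly j" k] by simp
  from has_integral_mult_right[OF this, of "sqrt (2 * real k + 1) * sqrt (2 * real j + 1)"]
  show ?case
    by (simp add: legendre01_eq_poly mult_ac split: if_splits)
qed

section \<open>Parseval's identity and the perturbed curve\<close>

text \<open>
  Parseval's identity in bilinear form, without conjugation, because the end point condition
  integrates a square and not a squared modulus.
\<close>
lemma has_integral_legendre01_expansions:
  fixes a b :: "nat \<Rightarrow> complex"
  shows "((\<lambda>t. (\<Sum>k\<le>m. a k * of_real (legendre01 k t)) * (\<Sum>k\<le>m. b k * of_real (legendre01 k t)))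
    has_integral (\<Sum>k\<le>m. a k * b k)) {0..1}"
proof -
  have "((\<lambda>t. \<Sum>j\<le>m. \<Sum>k\<le>m. a j * b k * of_real (legendre01 j t * legendre01 k t))
      has_integral (\<Sum>j\<le>m. \<Sum>k\<le>m. a j * b k * of_real (if j = k then 1 else 0))) {0..1}"
    by (intro has_integral_sum has_integral_mult_right has_integral_of_real legendre01_orthonormal) auto
  moreover have "(\<Sum>j\<le>m. \<Sum>k\<le>m. a j * b k * of_real (if j = k then 1 else 0)) = (\<Sum>j\<le>m. a j * b j)"
    by (intro sum.cong refl) (simp add: if_distrib sum.delta' cong: if_cong)
  ultimately show ?thesis
    by (simp add: sum_product mult_ac)
qed

theorem mainTheorem3:
  fixes m :: nat
    and c \<delta>c :: "nat \<Rightarrow> complex"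
    and w \<delta>w :: "real \<Rightarrow> complex"
    and \<rho> :: "nat \<Rightarrow> real"
    and d \<phi> :: real
  assumes w: "\<And>t. t \<in> {0..1} \<Longrightarrow> w t = (\<Sum>k=0..m. c k * complex_of_real (legendre01 k t))"
    and canonical: "integral {0..1} (\<lambda>t. (w t)\<^sup>2) = 1"
    and d: "d > 0"
    and \<delta>w: "\<And>t. t \<in> {0..1} \<Longrightarrow> \<delta>w t = (\<Sum>k=0..m. \<delta>c k * complex_of_real (legendre01 k t))"
    and \<delta>c: "\<And>k. k \<le> m \<Longrightarrow> \<delta>c k = complex_of_real (\<rho> k) * exp (\<i> * complex_of_real \<phi>)"
    and \<phi>: "\<phi> \<in> {-pi<..pi}"
  shows "(norm01 \<delta>w = d \<and> integral {0..1} (\<lambda>t. (w t + \<delta>w t)\<^sup>2) = 1) \<longleftrightarrow>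
    ((\<Sum>k=0..m. (\<rho> k)\<^sup>2) = d\<^sup>2 \<and>
     d\<^sup>2 * cos (2 * \<phi>) + 2 * (\<Sum>k=0..m. \<rho> k * (cos \<phi> * Re (c k) - sin \<phi> * Im (c k))) = 0 \<and>
     d\<^sup>2 * sin (2 * \<phi>) + 2 * (\<Sum>k=0..m. \<rho> k * (cos \<phi> * Im (c k) + sin \<phi> * Re (c k))) = 0)"
proof -
  define S where "S = (\<Sum>k\<le>m. (\<rho> k)\<^sup>2)"
  have square: "integral {0..1} (\<lambda>t. (f t)\<^sup>2) = (\<Sum>k\<le>m. (a k)\<^sup>2)"
    if "\<And>t. t \<in> {0..1} \<Longrightarrow> f t = (\<Sum>k\<le>m. a k * of_real (legendre01 k t))"
    for f :: "real \<Rightarrow> complex" and a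
    unfolding power2_eq_square
    by (rule integral_unique, rule has_integral_eq[OF _ has_integral_legendre01_expansions])
       (simp add: that)
  have c_sum: "(\<Sum>k\<le>m. (c k)\<^sup>2) = 1"
    using square[of w c] w canonical by (simp add: atLeast0AtMost)

  \<comment> \<open>The common phase has modulus 1, so the squared modulus is the square of a real expansion;
      writing it as a real part makes the complex Parseval identity applicable.\<close>
  have "(cmod (\<delta>w t))\<^sup>2 = Re ((\<Sum>k\<le>m. of_real (\<rho> k) * of_real (legendre01 k t)) * (\<Sum>k\<le>m. of_real (\<rho> k) * of_real (legendre01 k t)))"
    if "t \<in> {0..1}" for t
  proof -
    have "\<delta>w t = cis \<phi> * of_real (\<Sum>k\<le>m. \<rho> k * legendre01 k t)"
      using \<delta>w[OF that] \<delta>c by (simp add: atLeast0AtMost sum_distrib_left cis_conv_exp mult_ac)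
    then have "(cmod (\<delta>w t))\<^sup>2 = (\<Sum>k\<le>m. \<rho> k * legendre01 k t)\<^sup>2"
      by (simp only: norm_mult norm_cis norm_of_real) simp
    also have "\<dots> = Re (of_real ((\<Sum>k\<le>m. \<rho> k * legendre01 k t)\<^sup>2))"
      by (simp only: Re_complex_of_real)
    finally show ?thesis by (simp add: power2_eq_square)
  qed
  moreover have "((\<lambda>t. Re ((\<Sum>k\<le>m. of_real (\<rho> k) * of_real (legendre01 k t)) * (\<Sum>k\<le>m. of_real (\<rho> k) * of_real (legendre01 k t))))
      has_integral Re (\<Sum>k\<le>m. of_real (\<rho> k) * of_real (\<rho> k))) {0..1}"
    by (intro has_integral_Re has_integral_legendre01_expansions)
  ultimately have "((\<lambda>t. (cmod (\<delta>w t))\<^sup>2) has_integral Re (\<Sum>k\<le>m. of_real (\<rho> k) * of_real (\<rho> k))) {0..1}"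
    by (subst has_integral_cong)
  then have "integral {0..1} (\<lambda>t. (cmod (\<delta>w t))\<^sup>2) = S"
    by (simp add: integral_unique S_def power2_eq_square)
  then have norm: "norm01 \<delta>w = d \<longleftrightarrow> S = d\<^sup>2"
    using d by (auto simp: norm01_def S_def sum_nonneg)

  have cis_sq: "(cis \<phi>)\<^sup>2 = cis (2 * \<phi>)"
    by (simp add: power2_eq_square cis_mult)
  define T where "T = (\<Sum>k\<le>m. of_real (\<rho> k) * c k)"
  have "integral {0..1} (\<lambda>t. (w t + \<delta>w t)\<^sup>2) = (\<Sum>k\<le>m. (c k + \<delta>c k)\<^sup>2)"
    using w \<delta>w by (intro square) (simp add: atLeast0AtMost sum.distrib distrib_right)
  also have "\<dots> = (\<Sum>k\<le>m. (c k)\<^sup>2 + (of_real ((\<rho> k)\<^sup>2) * (cis \<phi>)\<^sup>2 + 2 * cis \<phi> * (of_real (\<rho> k) * c k)))"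
    using \<delta>c by (intro sum.cong refl) (simp add: power2_eq_square algebra_simps flip: cis_conv_exp)
  also have "\<dots> = 1 + (of_real S * cis (2 * \<phi>) + 2 * cis \<phi> * T)"
    unfolding sum.distrib c_sum S_def T_def of_real_sum sum_distrib_left sum_distrib_right
    by (simp add: cis_sq)
  finally have "integral {0..1} (\<lambda>t. (w t + \<delta>w t)\<^sup>2) = 1 \<longleftrightarrow> of_real S * cis (2 * \<phi>) + 2 * (cis \<phi> * T) = 0"
    by (simp add: mult.assoc)
  also have "\<dots> \<longleftrightarrow> S * cos (2 * \<phi>) + 2 * Re (cis \<phi> * T) = 0 \<and> S * sin (2 * \<phi>) + 2 * Im (cis \<phi> * T) = 0"
    by (simp add: complex_eq_iff)
  finally have ends: "integral {0..1} (\<lambda>t. (w t + \<delta>w t)\<^sup>2) = 1 \<longleftrightarrow>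
    S * cos (2 * \<phi>) + 2 * Re (cis \<phi> * T) = 0 \<and> S * sin (2 * \<phi>) + 2 * Im (cis \<phi> * T) = 0" .
  have "Re (cis \<phi> * T) = (\<Sum>k\<le>m. \<rho> k * (cos \<phi> * Re (c k) - sin \<phi> * Im (c k)))"
    and "Im (cis \<phi> * T) = (\<Sum>k\<le>m. \<rho> k * (cos \<phi> * Im (c k) + sin \<phi> * Re (c k)))"
    unfolding T_def sum_distrib_left Re_sum Im_sum
    by (intro sum.cong refl; simp add: algebra_simps)+
  then show ?thesis
    unfolding norm ends S_def atLeast0AtMost by auto
qed

end
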